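(* Two LPOD programs $P$ and $Q$ are ps-strongly equivalent if and only if their LPMLN translations $\tau^\times(P)$ and $\tau^\times(Q)$ are sp-strongly equivalent.
   Context: A literal is an atom $a$ or its classical negation $\neg a$. An ASP rule $r$ has the form $l_1\vee\cdots\vee l_k\leftarrow l_{k+1},\dots,l_m,\ not\ l_{m+1},\dots,\ not\ l_n$ with literals $l_i$; $h(r)$, $b^+(r)$, $b^-(r)$ are the head, positive body and negative body literal sets. An interpretation is a set of literals not containing both $a$ and $\neg a$ for any atom $a$. $I\models r$ iff ($b^+(r)\subseteq I$ and $b^-(r)\cap I=\emptyset$) implies $h(r)\cap I\neq\emptyset$. For an ASP program $\Pi$ the GL-reduct is $\Pi^I=\{h(r)\leftarrow b^+(r) : r\in\Pi,\ b^-(r)\cap I=\emptyset\}$, and $I$ is a stable model of $\Pi$ iff $I\models\Pi^I$ and no proper subset of $I$ satisfies $\Pi^I$. An LPOD program $P$ is a finite set of ASP rules (regular part $P^r$) and ordered disjunction rules $r$: $h_1\times\cdots\times h_n\leftarrow b^+(r),\ not\ b^-(r)$ with pairwise distinct literals (set $P^o$); $o(r)=n$. The $i$-th option $r^i$ is $h_i\leftarrow b^+(r),\ not\ b^-(r),\ not\ h_1,\dots,not\ h_{i-1}$. A candidate stable model of $P$ is a stable model of a program obtained from $P$ by replacing each rule of $P^o$ by one of its options; $\mathrm{CSM}(P)$ is their set. For $r\in P^o$ and interpretation $X$: $deg(r,X)=1$ if $X$ does not satisfy the body of $r$; $deg(r,X)=\min\{k: h_k\in X\}$ if $X$ satisfies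 the body and $h(r)\cap X\ne\emptyset$; $deg(r,X)=o(r)$ otherwise; $deg(P,X)=\sum_{r\in P^o}deg(r,X)$. LPOD programs $P,Q$ are ps-strongly equivalent iff for every LPOD program $R$, $\mathrm{CSM}(P\cup R)=\mathrm{CSM}(Q\cup R)$ and for all $X,Y\in\mathrm{CSM}(P\cup R)$, $deg(P\cup R,X)-deg(P\cup R,Y)=deg(Q\cup R,X)-deg(Q\cup R,Y)$. An LPMLN program is a finite set of weighted rules $w:r$, $r$ an ASP rule, $w$ a real number (soft) or the symbol $\alpha$ (hard); $P^s$, $P^h$ the soft/hard rules, $P_I=\{w:r\in P: I\models r\}$, $\overline{P}=\{r:w:r\in P\}$; $I$ is a stable model of $P$ iff it is a stable model of $\overline{P_I}$; a soft stable model is a stable model satisfying all hard rules; $\mathrm{SSM}(P)$ is their set; $W_s(P,X)=\exp(\sum_{w:r\in P^s,X\models r}w)$, $Pr_s(P,X)=W_s(P,X)/\sum_{X'\in\mathrm{SSM}(P)}W_s(P,X')$. LPMLN programs are sp-strongly equivalent iff for every LPMLN program $R$, $\mathrm{SSM}(P\cup R)=\mathrm{SSM}(Q\cup R)$ and $Pr_s(P\cup R,X)=Pr_s(Q\cup R,X)$ for all $X\in\mathrm{SSM}(P\cup R)$. The translation is $\tau^\times(P)=\{\alpha:r\mid r\in P^r\}\cup\{1:r^k\mid r\in P^o,1\le k\le o(r)\}\cup\{\alpha:\ \leftarrow b^+(r),not\ b^-(r),not\ h_1,\dots,not\ h_{o(r)}\mid r\in P^o\}$.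
   Formalization: LPOD and LPMLN programs are finite multisets of rules (not finite sets), with union as multiset sum, so equal options or rules are counted separately, and the set of atoms is assumed infinite; with sets, or with finitely many atoms, the claim fails. *)

theory Defs
  imports Complex_Main "HOL-Library.Multiset" "HOL-Library.FSet"
begin

text \<open>
  Programs are finite multisets of rules and the union \<open>P \<union> R\<close> is the multiset sum \<open>P + R\<close>:
  every rule occurrence contributes its own degree, resp. its own weight.  This matters for the
  translation into LPMLN, where distinct ordered disjunction rules may share an option
  (\<open>a \<times> b\<close> and \<open>a \<times> c\<close> both have the first option \<open>a\<close>): the weight of such an option has to be
  counted once per ordered rule, as the degree is.  If equal rules were identified, the two
  programs consisting of \<open>\<leftarrow> not a, not c\<close>, \<open>a \<times> b\<close>, \<open>c \<times> d \<leftarrow> not a\<close> and of these three rules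
  together with \<open>a \<times> c\<close> would have the same translation, although the degrees of their candidate
  stable models \<open>{a}\<close> and \<open>{b, c}\<close> differ by 1 in the former program and by 2 in the latter.
\<close>

section \<open>ASP programs\<close>

datatype 'a literal = Pos 'a | Neg 'a

datatype 'a asp_rule =
  Rule (head: "'a literal fset") (pbody: "'a literal fset") (nbody: "'a literal fset")

definition consistent :: "'a literal set \<Rightarrow> bool" where
  "consistent I \<longleftrightarrow> (\<nexists>a. Pos a \<in> I \<and> Neg a \<in> I)"

definition sat :: "'a literal set \<Rightarrow> 'a asp_rule \<Rightarrow> bool" (infix "\<Turnstile>" 50) where
  "I \<Turnstile> r \<longleftrightarrow>
    (fset (pbody r) \<subseteq> I \<and> fset (nbody r) \<inter> I = {} \<longrightarrow> fset (head r) \<inter> I \<noteq> {})"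

definition gl_reduct :: "'a asp_rule set \<Rightarrow> 'a literal set \<Rightarrow> 'a asp_rule set" where
  "gl_reduct \<Pi> I = {Rule (head r) (pbody r) {||} | r. r \<in> \<Pi> \<and> fset (nbody r) \<inter> I = {}}"

text \<open>
  Satisfaction and stability do not depend on multiplicities, so they are defined for the set of
  rules underlying an ASP program.
\<close>

definition stable_model :: "'a asp_rule set \<Rightarrow> 'a literal set \<Rightarrow> bool" where
  "stable_model \<Pi> I \<longleftrightarrow> consistent I \<and>
    (\<forall>r \<in> gl_reduct \<Pi> I. I \<Turnstile> r) \<and> (\<forall>J. J \<subset> I \<longrightarrow> \<not> (\<forall>r \<in> gl_reduct \<Pi> I. J \<Turnstile> r))"


section \<open>LPOD programs\<close>

datatype 'a od_rule =
  ODRule (choices: "'a literal list") (od_pbody: "'a literal fset") (od_nbody: "'a literal fset")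

datatype 'a lpod_rule =
  is_Regular: Regular (the_regular: "'a asp_rule")
| is_Ordered: Ordered (the_ordered: "'a od_rule")

type_synonym 'a lpod = "'a lpod_rule multiset"

definition od_rule_ok :: "'a od_rule \<Rightarrow> bool" where
  "od_rule_ok r \<longleftrightarrow> choices r \<noteq> [] \<and> distinct (choices r)"

definition regular_part :: "'a lpod \<Rightarrow> 'a asp_rule multiset" where
  "regular_part P = image_mset the_regular (filter_mset is_Regular P)"

definition ordered_part :: "'a lpod \<Rightarrow> 'a od_rule multiset" where
  "ordered_part P = image_mset the_ordered (filter_mset is_Ordered P)"

definition lpod_program :: "'a lpod \<Rightarrow> bool" where
  "lpod_program P \<longleftrightarrow> (\<forall>r \<in># ordered_part P. od_rule_ok r)"

definition option_count :: "'a od_rule \<Rightarrow> nat" where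
  "option_count r = length (choices r)"

text \<open>
  Options are numbered from 1 on, whereas list positions start at 0: \<open>h\<^sub>k\<close> is
  \<open>choices r ! (k - 1)\<close>.
\<close>

definition rule_option :: "'a od_rule \<Rightarrow> nat \<Rightarrow> 'a asp_rule" where
  "rule_option r k = Rule {|choices r ! (k - 1)|} (od_pbody r)
     (od_nbody r |\<union>| fset_of_list (take (k - 1) (choices r)))"

text \<open>\<open>rel_mset\<close> relates the two programs occurrence by occurrence.\<close>

definition split_program :: "'a lpod \<Rightarrow> 'a asp_rule multiset \<Rightarrow> bool" where
  "split_program P \<Pi> \<longleftrightarrow> rel_mset
     (\<lambda>r s. case r of
        Regular t \<Rightarrow> s = t
      | Ordered t \<Rightarrow> (\<exists>k \<in> {1..option_count t}. s = rule_option t k)) P \<Pi>"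

definition CSM :: "'a lpod \<Rightarrow> 'a literal set set" where
  "CSM P = {X. \<exists>\<Pi>. split_program P \<Pi> \<and> stable_model (set_mset \<Pi>) X}"

definition od_body_sat :: "'a literal set \<Rightarrow> 'a od_rule \<Rightarrow> bool" where
  "od_body_sat X r \<longleftrightarrow> fset (od_pbody r) \<subseteq> X \<and> fset (od_nbody r) \<inter> X = {}"

definition rule_deg :: "'a od_rule \<Rightarrow> 'a literal set \<Rightarrow> nat" where
  "rule_deg r X =
    (if \<not> od_body_sat X r then 1
     else if set (choices r) \<inter> X \<noteq> {}
       then Min {k \<in> {1..option_count r}. choices r ! (k - 1) \<in> X}
     else option_count r)"

definition deg :: "'a lpod \<Rightarrow> 'a literal set \<Rightarrow> nat" where
  "deg P X = (\<Sum>r \<in># ordered_part P. rule_deg r X)"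

definition ps_strongly_equivalent :: "'a lpod \<Rightarrow> 'a lpod \<Rightarrow> bool" where
  "ps_strongly_equivalent P Q \<longleftrightarrow> (\<forall>R. lpod_program R \<longrightarrow>
     CSM (P + R) = CSM (Q + R) \<and>
     (\<forall>X \<in> CSM (P + R). \<forall>Y \<in> CSM (P + R).
        int (deg (P + R) X) - int (deg (P + R) Y) = int (deg (Q + R) X) - int (deg (Q + R) Y)))"


section \<open>LPMLN programs\<close>

datatype weight = is_Soft: Soft (soft_weight: real) | is_Hard: Hard

type_synonym 'a lpmln = "(weight \<times> 'a asp_rule) multiset"

definition soft_part :: "'a lpmln \<Rightarrow> 'a lpmln" where
  "soft_part P = filter_mset (\<lambda>(w, r). is_Soft w) P"

definition hard_part :: "'a lpmln \<Rightarrow> 'a lpmln" where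
  "hard_part P = filter_mset (\<lambda>(w, r). is_Hard w) P"

definition satisfied_part :: "'a lpmln \<Rightarrow> 'a literal set \<Rightarrow> 'a lpmln" where
  "satisfied_part P I = filter_mset (\<lambda>(w, r). I \<Turnstile> r) P"

definition unweighted :: "'a lpmln \<Rightarrow> 'a asp_rule multiset" where
  "unweighted P = image_mset snd P"

definition lpmln_stable_model :: "'a lpmln \<Rightarrow> 'a literal set \<Rightarrow> bool" where
  "lpmln_stable_model P I \<longleftrightarrow> stable_model (set_mset (unweighted (satisfied_part P I))) I"

definition SSM :: "'a lpmln \<Rightarrow> 'a literal set set" where
  "SSM P = {I. lpmln_stable_model P I \<and> (\<forall>(w, r) \<in># hard_part P. I \<Turnstile> r)}"

definition W_s :: "'a lpmln \<Rightarrow> 'a literal set \<Rightarrow> real" where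
  "W_s P X = exp (\<Sum>(w, r) \<in># satisfied_part (soft_part P) X. soft_weight w)"

definition Pr_s :: "'a lpmln \<Rightarrow> 'a literal set \<Rightarrow> real" where
  "Pr_s P X = W_s P X / (\<Sum>X' \<in> SSM P. W_s P X')"

text \<open>
  The sum in \<open>Pr_s\<close> is a genuine one: stable models contain only literals from rule heads, so
  there are only finitely many, even if there are infinitely many atoms.
\<close>

lemma stable_model_subset_heads:
  assumes "stable_model \<Pi> I"
  shows "I \<subseteq> (\<Union>r\<in>\<Pi>. fset (head r))"
proof (rule ccontr)
  let ?H = "\<Union>r\<in>\<Pi>. fset (head r)"
  assume "\<not> I \<subseteq> ?H"
  then have "I \<inter> ?H \<subset> I" by blast
  moreover have "I \<inter> ?H \<Turnstile> r" if r: "r \<in> gl_reduct \<Pi> I" for r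
  proof -
    have "I \<Turnstile> r" using assms r by (auto simp: stable_model_def)
    moreover have "fset (head r) \<subseteq> ?H" "nbody r = {||}"
      using r by (auto simp: gl_reduct_def)
    ultimately show ?thesis by (auto simp: sat_def)
  qed
  ultimately show False using assms by (auto simp: stable_model_def)
qed

lemma finite_SSM: "finite (SSM P)"
proof (rule finite_subset)
  let ?H = "\<Union>r\<in>set_mset (unweighted P). fset (head r)"
  show "SSM P \<subseteq> Pow ?H"
  proof
    fix I assume "I \<in> SSM P"
    then have "stable_model (set_mset (unweighted (satisfied_part P I))) I"
      by (simp add: SSM_def lpmln_stable_model_def)
    from stable_model_subset_heads[OF this] show "I \<in> Pow ?H"
      by (fastforce simp: unweighted_def satisfied_part_def)
  qed
  show "finite (Pow ?H)" by simp
qed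

definition sp_strongly_equivalent :: "'a lpmln \<Rightarrow> 'a lpmln \<Rightarrow> bool" where
  "sp_strongly_equivalent P Q \<longleftrightarrow> (\<forall>R.
     SSM (P + R) = SSM (Q + R) \<and> (\<forall>X \<in> SSM (P + R). Pr_s (P + R) X = Pr_s (Q + R) X))"


section \<open>Translation of LPOD programs into LPMLN programs\<close>

definition lpod_to_lpmln :: "'a lpod \<Rightarrow> 'a lpmln" where
  "lpod_to_lpmln P =
     image_mset (\<lambda>r. (Hard, r)) (regular_part P)
   + (\<Sum>r \<in># ordered_part P.
        image_mset (\<lambda>k. (Soft 1, rule_option r k)) (mset_set {1..option_count r}))
   + image_mset
       (\<lambda>r. (Hard, Rule {||} (od_pbody r) (od_nbody r |\<union>| fset_of_list (choices r))))
       (ordered_part P)"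

end

theory Submission
  imports Defs
begin

text \<open>
  The candidate stable models of \<open>P\<close> are the soft stable models of its translation, and on them
  the weight of \<open>X\<close> is \<open>exp (c - deg P X)\<close> with \<open>c\<close> independent of \<open>X\<close>, since \<open>X\<close> satisfies all
  but \<open>rule_deg r X - 1\<close> options of an ordered rule \<open>r\<close>.  This makes sp-strong equivalence of the
  translations imply ps-strong equivalence.  Conversely, to test an interpretation \<open>X\<close> in an LPMLN
  context one may replace the context by the rules of it that \<open>X\<close> satisfies, taken as regular rules;
  hence the soft stable models agree.  To compare the degrees of two interpretations \<open>X\<close>, \<open>Y\<close> in
  one LPOD context, take fresh atoms \<open>a\<close>, \<open>b\<close> and the rules \<open>a \<or> b\<close>, \<open>x \<leftarrow> a\<close> for \<open>x \<in> X\<close>, and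
  \<open>y \<leftarrow> b\<close> for \<open>y \<in> Y\<close>: then \<open>X \<union> {a}\<close> and \<open>Y \<union> {b}\<close> are candidate stable models with the
  degrees of \<open>X\<close> and \<open>Y\<close>.
\<close>

section \<open>Stability in terms of applicable rules\<close>

definition applicable :: "'a asp_rule \<Rightarrow> 'a literal set \<Rightarrow> bool" where
  "applicable r X \<longleftrightarrow> fset (pbody r) \<subseteq> X \<and> fset (nbody r) \<inter> X = {}"

lemma sat_iff_applicable: "X \<Turnstile> r \<longleftrightarrow> (applicable r X \<longrightarrow> fset (head r) \<inter> X \<noteq> {})"
  by (simp add: sat_def applicable_def)

lemma sat_reduct_rule: "J \<Turnstile> Rule H B {||} \<longleftrightarrow> (fset B \<subseteq> J \<longrightarrow> fset H \<inter> J \<noteq> {})"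
  by (simp add: sat_def)

lemma sat_gl_reduct_iff:
  "(\<forall>r \<in> gl_reduct \<Pi> X. J \<Turnstile> r) \<longleftrightarrow>
    (\<forall>r \<in> \<Pi>. fset (nbody r) \<inter> X = {} \<longrightarrow> fset (pbody r) \<subseteq> J \<longrightarrow> fset (head r) \<inter> J \<noteq> {})"
  unfolding gl_reduct_def by (auto simp: sat_reduct_rule)

text \<open>If a subset \<open>J\<close> of \<open>X\<close> violates a rule of the reduct, the
  positive body of that rule lies in \<open>J\<close> and hence in \<open>X\<close>. So minimality
  is decided by rules applicable in \<open>X\<close> itself, and the reduct disappears from the
  later arguments.\<close>

lemma stable_model_iff:
  "stable_model \<Pi> X \<longleftrightarrow> consistent X \<and> (\<forall>r \<in> \<Pi>. X \<Turnstile> r) \<and>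
    (\<forall>J. J \<subset> X \<longrightarrow> (\<exists>r \<in> \<Pi>. applicable r X \<and> fset (pbody r) \<subseteq> J \<and> fset (head r) \<inter> J = {}))"
proof -
  have "(\<forall>r \<in> gl_reduct \<Pi> X. X \<Turnstile> r) \<longleftrightarrow> (\<forall>r \<in> \<Pi>. X \<Turnstile> r)"
    unfolding sat_gl_reduct_iff unfolding sat_def by metis
  moreover have "(J \<subset> X \<longrightarrow> \<not> (\<forall>r \<in> gl_reduct \<Pi> X. J \<Turnstile> r)) \<longleftrightarrow> (J \<subset> X \<longrightarrow>
      (\<exists>r \<in> \<Pi>. applicable r X \<and> fset (pbody r) \<subseteq> J \<and> fset (head r) \<inter> J = {}))" for J
    unfolding sat_gl_reduct_iff applicable_def by (meson order.trans psubset_imp_subset)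
  ultimately show ?thesis unfolding stable_model_def by (simp only:)
qed

text \<open>The witnesses of minimality are applicable rules, and these survive in
  \<open>\<Pi>'\<close>. Adding rules satisfied by \<open>X\<close> or dropping inapplicable ones
  therefore preserves stability.\<close>

lemma stable_model_transfer:
  assumes "stable_model \<Pi> X" "\<And>r. r \<in> \<Pi>' \<Longrightarrow> X \<Turnstile> r"
    and "\<And>r. r \<in> \<Pi> \<Longrightarrow> applicable r X \<Longrightarrow> r \<in> \<Pi>'"
  shows "stable_model \<Pi>' X"
  unfolding stable_model_iff
proof (intro conjI ballI allI impI)
  show "consistent X" using assms(1) by (simp add: stable_model_iff)
  show "X \<Turnstile> r" if "r \<in> \<Pi>'" for r using assms(2) that .
  fix J assume "J \<subset> X"
  with assms(1) obtain r where "r \<in> \<Pi>" "applicable r X" "fset (pbody r) \<subseteq> J" "fset (head r) \<inter> J = {}"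
    unfolding stable_model_iff by meson
  with assms(3) show "\<exists>r \<in> \<Pi>'. applicable r X \<and> fset (pbody r) \<subseteq> J \<and> fset (head r) \<inter> J = {}"
    by (intro bexI[of _ r]) simp_all
qed

section \<open>Soft stable models and soft weights\<close>

lemma SSM_iff:
  "X \<in> SSM P \<longleftrightarrow> stable_model {r. X \<Turnstile> r \<and> (\<exists>w. (w, r) \<in># P)} X \<and>
    (\<forall>r. (Hard, r) \<in># P \<longrightarrow> X \<Turnstile> r)"
proof -
  have "set_mset (unweighted (satisfied_part P X)) = {r. X \<Turnstile> r \<and> (\<exists>w. (w, r) \<in># P)}"
    by (force simp: unweighted_def satisfied_part_def)
  moreover have "(\<forall>(w, r) \<in># hard_part P. X \<Turnstile> r) \<longleftrightarrow> (\<forall>r. (Hard, r) \<in># P \<longrightarrow> X \<Turnstile> r)"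
    by (auto simp: hard_part_def is_Hard_def)
  ultimately show ?thesis by (simp add: SSM_def lpmln_stable_model_def)
qed

lemma finite_of_SSM: "X \<in> SSM P \<Longrightarrow> finite X"
proof -
  assume "X \<in> SSM P"
  then have "stable_model (set_mset (unweighted (satisfied_part P X))) X"
    by (simp add: SSM_def lpmln_stable_model_def)
  from stable_model_subset_heads[OF this] show ?thesis
    by (rule finite_subset) simp
qed

lemma consistent_of_SSM: "X \<in> SSM P \<Longrightarrow> consistent X"
  by (simp add: SSM_iff stable_model_iff)

text \<open>The exponent of \<open>W_s\<close>, kept separate because it is additive over multiset
  sums.\<close>

definition soft_score :: "'a lpmln \<Rightarrow> 'a literal set \<Rightarrow> real" where
  "soft_score P X = (\<Sum>(w, r) \<in># satisfied_part (soft_part P) X. soft_weight w)"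

lemma W_s_eq_exp: "W_s P X = exp (soft_score P X)"
  by (simp add: W_s_def soft_score_def)

lemma soft_score_union [simp]: "soft_score (P + Q) X = soft_score P X + soft_score Q X"
  by (simp add: soft_score_def satisfied_part_def soft_part_def)

lemma W_s_pos: "W_s P X > 0"
  by (simp add: W_s_eq_exp)

lemma soft_score_empty [simp]: "soft_score {#} X = 0"
  by (simp add: soft_score_def satisfied_part_def soft_part_def)

lemma soft_score_add_mset [simp]:
  "soft_score (add_mset (w, r) P) X =
    (if is_Soft w \<and> X \<Turnstile> r then soft_weight w else 0) + soft_score P X"
  by (simp add: soft_score_def satisfied_part_def soft_part_def)

lemma soft_score_image_mset_set:
  assumes "finite A"
  shows "soft_score (image_mset (\<lambda>k. (Soft 1, f k)) (mset_set A)) X = card {k \<in> A. X \<Turnstile> f k}"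
  using assms
proof (induction A)
  case (insert a A)
  have "{k \<in> insert a A. X \<Turnstile> f k} =
      (if X \<Turnstile> f a then insert a {k \<in> A. X \<Turnstile> f k} else {k \<in> A. X \<Turnstile> f k})"
    by auto
  with insert show ?case by simp
qed simp

section \<open>Options of an ordered rule and its degree\<close>

text \<open>The hard constraint of the translation. Where it holds, \<open>rule_deg\<close> never
  reaches its third case, in which the body holds but no choice does.\<close>

definition od_constraint :: "'a od_rule \<Rightarrow> 'a asp_rule" where
  "od_constraint r = Rule {||} (od_pbody r) (od_nbody r |\<union>| fset_of_list (choices r))"

lemma applicable_rule_option:
  "applicable (rule_option r k) X \<longleftrightarrow>
    od_body_sat X r \<and> set (take (k - 1) (choices r)) \<inter> X = {}"
  by (auto simp: applicable_def rule_option_def od_body_sat_def fset_of_list.rep_eq)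

lemma sat_rule_option:
  "X \<Turnstile> rule_option r k \<longleftrightarrow> (od_body_sat X r \<longrightarrow>
    set (take (k - 1) (choices r)) \<inter> X = {} \<longrightarrow> choices r ! (k - 1) \<in> X)"
  unfolding sat_iff_applicable applicable_rule_option by (auto simp: rule_option_def)

lemma sat_od_constraint:
  "X \<Turnstile> od_constraint r \<longleftrightarrow> (od_body_sat X r \<longrightarrow> set (choices r) \<inter> X \<noteq> {})"
  by (auto simp: sat_def od_constraint_def od_body_sat_def fset_of_list.rep_eq)

text \<open>Passes from list prefixes, with positions from 0, to option numbers from 1.\<close>

lemma set_take_inter_empty_iff:
  assumes "k \<in> {1..length xs}"
  shows "set (take (k - 1) xs) \<inter> X = {} \<longleftrightarrow> (\<forall>j \<in> {1..<k}. xs ! (j - 1) \<notin> X)"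
proof -
  have "set (take (k - 1) xs) = (\<lambda>j. xs ! j) ` {0..<k - 1}"
    using assms by (subst nth_image) auto
  also have "{0..<k - 1} = (\<lambda>j. j - 1) ` {1..<k}"
    by (auto simp: image_iff intro!: bexI[of _ "Suc _"])
  finally show ?thesis by (auto simp: image_image)
qed

lemma rule_deg_props:
  assumes "od_body_sat X r" "set (choices r) \<inter> X \<noteq> {}"
  shows "rule_deg r X \<in> {1..option_count r}" "choices r ! (rule_deg r X - 1) \<in> X"
    and "\<And>k. k \<in> {1..option_count r} \<Longrightarrow> choices r ! (k - 1) \<in> X \<Longrightarrow> rule_deg r X \<le> k"
proof -
  let ?S = "{k \<in> {1..option_count r}. choices r ! (k - 1) \<in> X}"
  have deg: "rule_deg r X = Min ?S" using assms by (simp add: rule_deg_def)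
  obtain i where "i < length (choices r)" "choices r ! i \<in> X"
    using assms(2) by (auto simp: in_set_conv_nth)
  \<comment> \<open>List position \<open>i\<close> is option number \<open>i + 1\<close>.\<close>
  then have "Suc i \<in> ?S" by (simp add: option_count_def)
  then have "Min ?S \<in> ?S" by (intro Min_in) auto
  then show "rule_deg r X \<in> {1..option_count r}" "choices r ! (rule_deg r X - 1) \<in> X"
    unfolding deg by auto
  show "rule_deg r X \<le> k" if "k \<in> {1..option_count r}" "choices r ! (k - 1) \<in> X" for k
    unfolding deg using that by (intro Min_le) auto
qed

text \<open>Option \<open>k\<close> fails exactly when the body holds and none of the first
  \<open>k\<close> choices is in \<open>X\<close>. Given the constraint, this says that the least
  true choice comes after \<open>k\<close>. If the body fails, the degree is 1 and every option
  holds.\<close>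

lemma sat_rule_option_iff_deg_le:
  assumes "od_rule_ok r" "X \<Turnstile> od_constraint r" "k \<in> {1..option_count r}"
  shows "X \<Turnstile> rule_option r k \<longleftrightarrow> rule_deg r X \<le> k"
proof (cases "od_body_sat X r")
  case False
  with assms show ?thesis by (simp add: sat_rule_option rule_deg_def)
next
  case True
  with assms have ne: "set (choices r) \<inter> X \<noteq> {}" by (simp add: sat_od_constraint)
  note d = rule_deg_props[OF True ne]
  have "(\<forall>j \<in> {1..<k}. choices r ! (j - 1) \<notin> X) \<longleftrightarrow> k \<le> rule_deg r X"
  proof
    assume "\<forall>j \<in> {1..<k}. choices r ! (j - 1) \<notin> X"
    with d(1,2) show "k \<le> rule_deg r X" by (metis atLeastAtMost_iff atLeastLessThan_iff not_le)
  next
    assume "k \<le> rule_deg r X"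
    with d(3) assms(3) show "\<forall>j \<in> {1..<k}. choices r ! (j - 1) \<notin> X" by fastforce
  qed
  moreover have "set (take (k - 1) (choices r)) \<inter> X = {} \<longleftrightarrow>
      (\<forall>j \<in> {1..<k}. choices r ! (j - 1) \<notin> X)"
    using assms(3) by (intro set_take_inter_empty_iff) (simp add: option_count_def)
  ultimately show ?thesis
    unfolding sat_rule_option using True d(2) d(3)[OF assms(3)] by (metis le_antisym nle_le)
qed

lemma rule_deg_range:
  assumes "od_rule_ok r"
  shows "rule_deg r X \<in> {1..option_count r}"
proof (cases "od_body_sat X r \<and> set (choices r) \<inter> X \<noteq> {}")
  case True
  then show ?thesis using rule_deg_props(1) by blast
next
  case False
  have "option_count r \<ge> 1"
    using assms by (simp add: od_rule_ok_def option_count_def Suc_le_eq)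
  with False show ?thesis by (auto simp: rule_deg_def)
qed

text \<open>The satisfied options are those numbered from the degree up to
  \<open>option_count r\<close>.\<close>

lemma card_satisfied_option_indices:
  assumes "od_rule_ok r" "X \<Turnstile> od_constraint r"
  shows "real (card {k \<in> {1..option_count r}. X \<Turnstile> rule_option r k}) =
    real (option_count r) + 1 - real (rule_deg r X)"
proof -
  have "{k \<in> {1..option_count r}. X \<Turnstile> rule_option r k} = {rule_deg r X..option_count r}"
    using sat_rule_option_iff_deg_le[OF assms] rule_deg_range[OF assms(1), of X] by auto
  then show ?thesis using rule_deg_range[OF assms(1), of X] by auto
qed

section \<open>Program parts, degrees and the translation under multiset sums\<close>

lemma regular_part_simps [simp]:
  "regular_part {#} = {#}"
  "regular_part (P + Q) = regular_part P + regular_part Q"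
  "regular_part (add_mset (Regular t) P) = add_mset t (regular_part P)"
  "regular_part (add_mset (Ordered r) P) = regular_part P"
  by (simp_all add: regular_part_def)

lemma ordered_part_simps [simp]:
  "ordered_part {#} = {#}"
  "ordered_part (P + Q) = ordered_part P + ordered_part Q"
  "ordered_part (add_mset (Regular t) P) = ordered_part P"
  "ordered_part (add_mset (Ordered r) P) = add_mset r (ordered_part P)"
  by (simp_all add: ordered_part_def)

lemma in_regular_part [simp]: "t \<in># regular_part P \<longleftrightarrow> Regular t \<in># P"
  by (force simp: regular_part_def is_Regular_def)

lemma in_ordered_part [simp]: "t \<in># ordered_part P \<longleftrightarrow> Ordered t \<in># P"
  by (force simp: ordered_part_def is_Ordered_def)

lemma regular_part_image_Regular [simp]: "regular_part (image_mset Regular M) = M"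
  by (induction M) simp_all

lemma ordered_part_image_Regular [simp]: "ordered_part (image_mset Regular M) = {#}"
  by (induction M) simp_all

lemma lpod_program_union [simp]:
  "lpod_program (P + Q) \<longleftrightarrow> lpod_program P \<and> lpod_program Q"
  by (auto simp: lpod_program_def)

lemma lpod_program_image_Regular [simp]: "lpod_program (image_mset Regular M)"
  by (simp add: lpod_program_def)

lemma deg_union [simp]: "deg (P + Q) X = deg P X + deg Q X"
  by (simp add: deg_def)

lemma deg_image_Regular [simp]: "deg (image_mset Regular M) X = 0"
  by (simp add: deg_def)

lemma lpod_to_lpmln_union [simp]:
  "lpod_to_lpmln (P + Q) = lpod_to_lpmln P + lpod_to_lpmln Q"
  by (simp add: lpod_to_lpmln_def)

lemma lpod_to_lpmln_image_Regular [simp]: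
  "lpod_to_lpmln (image_mset Regular M) = image_mset (\<lambda>r. (Hard, r)) M"
  by (simp add: lpod_to_lpmln_def)

lemma in_lpod_to_lpmln:
  "(w, s) \<in># lpod_to_lpmln P \<longleftrightarrow> w = Hard \<and> Regular s \<in># P
    \<or> w = Soft 1 \<and> (\<exists>r. Ordered r \<in># P \<and> (\<exists>k \<in> {1..option_count r}. s = rule_option r k))
    \<or> w = Hard \<and> (\<exists>r. Ordered r \<in># P \<and> s = od_constraint r)"
  by (auto simp: lpod_to_lpmln_def od_constraint_def)

section \<open>Candidate stable models as soft stable models of the translation\<close>

definition satisfies_hard :: "'a literal set \<Rightarrow> 'a lpod \<Rightarrow> bool" where
  "satisfies_hard X P \<longleftrightarrow> (\<forall>s. Regular s \<in># P \<longrightarrow> X \<Turnstile> s) \<and>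
    (\<forall>r. Ordered r \<in># P \<longrightarrow> X \<Turnstile> od_constraint r)"

lemma satisfies_hard_iff:
  "satisfies_hard X P \<longleftrightarrow> (\<forall>s. (Hard, s) \<in># lpod_to_lpmln P \<longrightarrow> X \<Turnstile> s)"
  by (auto simp: satisfies_hard_def in_lpod_to_lpmln)

lemma satisfies_hard_of_SSM: "X \<in> SSM (lpod_to_lpmln P + R) \<Longrightarrow> satisfies_hard X P"
  by (simp add: SSM_iff satisfies_hard_iff)

text \<open>Each ordered rule is replaced by the option whose number is its degree in
  \<open>X\<close>. Among the satisfied options of that rule it is the only one that can be
  applicable, so \<open>stable_model_transfer\<close> applies.\<close>

lemma SSM_subset_CSM:
  assumes "lpod_program P"
  shows "SSM (lpod_to_lpmln P) \<subseteq> CSM P"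
proof
  fix X assume "X \<in> SSM (lpod_to_lpmln P)"
  then have stab: "stable_model {r. X \<Turnstile> r \<and> (\<exists>w. (w, r) \<in># lpod_to_lpmln P)} X"
    and hard: "satisfies_hard X P"
    by (simp_all add: SSM_iff satisfies_hard_iff)
  let ?f = "\<lambda>r. case r of Regular t \<Rightarrow> t | Ordered t \<Rightarrow> rule_option t (rule_deg t X)"
  have ok: "od_rule_ok t" if "Ordered t \<in># P" for t
    using assms that by (simp add: lpod_program_def)
  have "split_program P (image_mset ?f P)"
    unfolding split_program_def multiset.rel_map
  proof (rule multiset.rel_refl_strong)
    fix r assume r: "r \<in># P"
    show "case r of Regular t \<Rightarrow> ?f r = t
      | Ordered t \<Rightarrow> \<exists>k \<in> {1..option_count t}. ?f r = rule_option t k"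
    proof (cases r)
      case (Ordered t)
      with r ok have "rule_deg t X \<in> {1..option_count t}" by (intro rule_deg_range) simp
      with Ordered show ?thesis by auto
    qed simp
  qed
  moreover have "stable_model (set_mset (image_mset ?f P)) X"
  proof (rule stable_model_transfer[OF stab])
    fix s assume "s \<in> set_mset (image_mset ?f P)"
    then obtain r where r: "r \<in># P" "s = ?f r" by auto
    show "X \<Turnstile> s"
    proof (cases r)
      case (Regular t)
      with r hard show ?thesis by (simp add: satisfies_hard_def)
    next
      case (Ordered t)
      with r hard ok have "X \<Turnstile> od_constraint t" "od_rule_ok t"
        by (simp_all add: satisfies_hard_def)
      then have "X \<Turnstile> rule_option t (rule_deg t X)"
        using sat_rule_option_iff_deg_le rule_deg_range by blast
      with r Ordered show ?thesis by simp
    qed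
  next
    fix s assume s: "s \<in> {r. X \<Turnstile> r \<and> (\<exists>w. (w, r) \<in># lpod_to_lpmln P)}" "applicable s X"
    then consider "Regular s \<in># P"
      | t k where "Ordered t \<in># P" "k \<in> {1..option_count t}" "s = rule_option t k"
      | t where "s = od_constraint t"
      by (auto simp: in_lpod_to_lpmln)
    then show "s \<in> set_mset (image_mset ?f P)"
    proof cases
      case 1
      then show ?thesis
        unfolding set_image_mset by (intro image_eqI[of _ _ "Regular s"]) simp_all
    next
      case 2
      have con: "X \<Turnstile> od_constraint t" using hard 2 by (simp add: satisfies_hard_def)
      have app: "od_body_sat X t" "set (take (k - 1) (choices t)) \<inter> X = {}"
        using s(2) 2 by (simp_all add: applicable_rule_option)
      with con have ne: "set (choices t) \<inter> X \<noteq> {}" by (simp add: sat_od_constraint)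
      \<comment> \<open>Satisfaction of option \<open>k\<close> bounds the degree from above.
        Applicability, which excludes all earlier choices, bounds it from below.\<close>
      have "rule_deg t X \<le> k"
        using sat_rule_option_iff_deg_le[OF ok[OF 2(1)] con 2(2)] s(1) 2(3) by simp
      moreover have "\<not> rule_deg t X < k"
        using app(2) rule_deg_props(1,2)[OF app(1) ne] 2(2)
        by (subst (asm) set_take_inter_empty_iff) (auto simp: option_count_def)
      ultimately have "s = ?f (Ordered t)" using 2(3) by simp
      then show ?thesis
        unfolding set_image_mset using 2(1) by (rule image_eqI)
    next
      case 3
      \<comment> \<open>An applicable constraint has an empty head and cannot be satisfied, so this
        case is contradictory.\<close>
      with s show ?thesis by (simp add: sat_iff_applicable od_constraint_def)
    qed
  qed
  ultimately show "X \<in> CSM P" by (auto simp: CSM_def)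
qed

text \<open>Every rule of the split program occurs in the translation and is satisfied, so stability
  transfers. A satisfied option yields the hard constraint: if the body holds, its own head or an
  earlier choice is in \<open>X\<close>.\<close>

lemma CSM_subset_SSM: "CSM P \<subseteq> SSM (lpod_to_lpmln P)"
proof
  fix X assume "X \<in> CSM P"
  then obtain \<Pi> where split: "split_program P \<Pi>" and stab: "stable_model (set_mset \<Pi>) X"
    by (auto simp: CSM_def)
  \<comment> \<open>Stability depends only on the underlying sets, so the multiset relation is
    weakened to a relation between sets.\<close>
  from split have rel: "rel_set (\<lambda>r s. case r of Regular t \<Rightarrow> s = t
      | Ordered t \<Rightarrow> (\<exists>k \<in> {1..option_count t}. s = rule_option t k)) (set_mset P) (set_mset \<Pi>)"
    unfolding split_program_def by (rule rel_funD[OF multiset.set_transfer])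
  have sat: "X \<Turnstile> s" if "s \<in># \<Pi>" for s
    using stab that by (simp add: stable_model_iff)
  have "satisfies_hard X P"
    unfolding satisfies_hard_def
  proof (intro conjI allI impI)
    fix s assume "Regular s \<in># P"
    with rel_setD1[OF rel this] sat show "X \<Turnstile> s" by auto
  next
    fix r assume "Ordered r \<in># P"
    from rel_setD1[OF rel this] obtain k where k: "k \<in> {1..option_count r}" "rule_option r k \<in># \<Pi>"
      by auto
    then have "choices r ! (k - 1) \<in> set (choices r)"
      by (intro nth_mem) (auto simp: option_count_def)
    then show "X \<Turnstile> od_constraint r"
      using sat[OF k(2)] in_set_takeD unfolding sat_rule_option sat_od_constraint by fast
  qed
  moreover have "stable_model {r. X \<Turnstile> r \<and> (\<exists>w. (w, r) \<in># lpod_to_lpmln P)} X"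
  proof (rule stable_model_transfer[OF stab])
    fix s assume s: "s \<in> set_mset \<Pi>"
    from rel_setD2[OF rel this] obtain r where r: "r \<in># P" "case r of Regular t \<Rightarrow> s = t
        | Ordered t \<Rightarrow> (\<exists>k \<in> {1..option_count t}. s = rule_option t k)"
      by blast
    have "\<exists>w. (w, s) \<in># lpod_to_lpmln P"
    proof (cases r)
      case (Regular t)
      with r have "(Hard, s) \<in># lpod_to_lpmln P" by (simp add: in_lpod_to_lpmln)
      then show ?thesis ..
    next
      case (Ordered t)
      with r have "(Soft 1, s) \<in># lpod_to_lpmln P" by (simp add: in_lpod_to_lpmln) blast
      then show ?thesis ..
    qed
    with sat s show "s \<in> {r. X \<Turnstile> r \<and> (\<exists>w. (w, r) \<in># lpod_to_lpmln P)}" by simp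
  qed simp
  ultimately show "X \<in> SSM (lpod_to_lpmln P)" by (simp add: SSM_iff satisfies_hard_iff)
qed

lemma CSM_eq_SSM: "lpod_program P \<Longrightarrow> CSM P = SSM (lpod_to_lpmln P)"
  by (simp add: CSM_subset_SSM SSM_subset_CSM subset_antisym)

section \<open>Weights as degrees\<close>

text \<open>The part of the weight exponent that is independent of the interpretation; the summand
  comes from \<open>card_satisfied_option_indices\<close>.\<close>

definition max_score :: "'a lpod \<Rightarrow> real" where
  "max_score P = (\<Sum>r \<in># ordered_part P. real (option_count r) + 1)"

text \<open>The induction runs over rule occurrences, so an option shared by several ordered rules
  counts once for each of them.\<close>

lemma soft_score_lpod_to_lpmln:
  assumes "lpod_program P" "satisfies_hard X P"
  shows "soft_score (lpod_to_lpmln P) X = max_score P - real (deg P X)"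
  using assms
proof (induction P)
  case empty
  show ?case by (simp add: lpod_to_lpmln_def max_score_def deg_def)
next
  case (add r P)
  then have IH: "soft_score (lpod_to_lpmln P) X = max_score P - real (deg P X)"
    by (cases r) (auto simp: lpod_program_def satisfies_hard_def)
  show ?case
  proof (cases r)
    case (Regular t)
    then have "lpod_to_lpmln (add_mset r P) = add_mset (Hard, t) (lpod_to_lpmln P)"
      by (simp add: lpod_to_lpmln_def)
    with IH Regular show ?thesis by (simp add: max_score_def deg_def)
  next
    case (Ordered t)
    then have "lpod_to_lpmln (add_mset r P) = add_mset (Hard, od_constraint t)
        (image_mset (\<lambda>k. (Soft 1, rule_option t k)) (mset_set {1..option_count t})
          + lpod_to_lpmln P)"
      by (simp add: lpod_to_lpmln_def od_constraint_def)
    moreover have "od_rule_ok t" "X \<Turnstile> od_constraint t"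
      using add.prems Ordered by (simp_all add: lpod_program_def satisfies_hard_def)
    note card_satisfied_option_indices[OF this]
    ultimately show ?thesis
      using IH Ordered by (simp add: soft_score_image_mset_set max_score_def deg_def)
  qed
qed

section \<open>From LPMLN contexts to LPOD contexts\<close>

text \<open>
  Soft rules violated by \<open>X\<close> play no role in testing \<open>X\<close>, so an LPMLN context can be replaced by
  a context of regular LPOD rules that depends on \<open>X\<close>.
\<close>

lemma SSM_context_iff:
  "X \<in> SSM (A + R) \<longleftrightarrow> (\<forall>r. (Hard, r) \<in># R \<longrightarrow> X \<Turnstile> r) \<and>
    X \<in> SSM (A + lpod_to_lpmln (image_mset Regular (unweighted (satisfied_part R X))))"
proof -
  have "{r. X \<Turnstile> r \<and> (\<exists>w. (w, r) \<in># A + R)} = {r. X \<Turnstile> r \<and> (\<exists>w. (w, r) \<in># A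
      + lpod_to_lpmln (image_mset Regular (unweighted (satisfied_part R X))))}"
    by (force simp: unweighted_def satisfied_part_def)
  then show ?thesis
    unfolding SSM_iff by (auto simp: unweighted_def satisfied_part_def)
qed

text \<open>The replacement context varies with \<open>X\<close>, so the hypothesis is used at a
  separate LPOD context for each \<open>X\<close>.\<close>

lemma SSM_context_subset:
  assumes "lpod_program P" "lpod_program Q"
    and CSM: "\<And>R. lpod_program R \<Longrightarrow> CSM (P + R) = CSM (Q + R)"
  shows "SSM (lpod_to_lpmln P + R) \<subseteq> SSM (lpod_to_lpmln Q + R)"
proof
  fix X assume X: "X \<in> SSM (lpod_to_lpmln P + R)"
  let ?R = "image_mset Regular (unweighted (satisfied_part R X))"
  have "SSM (lpod_to_lpmln (P + ?R)) = SSM (lpod_to_lpmln (Q + ?R))"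
    using CSM[of ?R] assms(1,2) by (simp add: CSM_eq_SSM del: lpod_to_lpmln_union)
  with X show "X \<in> SSM (lpod_to_lpmln Q + R)"
    unfolding SSM_context_iff[of X _ R] lpod_to_lpmln_union by simp
qed

section \<open>Fresh atoms and the selector context\<close>

definition lpod_literals :: "'a lpod \<Rightarrow> 'a literal set" where
  "lpod_literals P =
    (\<Union>r \<in> set_mset (regular_part P). fset (head r) \<union> fset (pbody r) \<union> fset (nbody r)) \<union>
    (\<Union>r \<in> set_mset (ordered_part P). set (choices r) \<union> fset (od_pbody r) \<union> fset (od_nbody r))"

lemma finite_lpod_literals: "finite (lpod_literals P)"
  unfolding lpod_literals_def by simp

lemma sat_insert_fresh:
  assumes "p \<notin> fset (head r)" "p \<notin> fset (pbody r)" "p \<notin> fset (nbody r)"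
  shows "insert p X \<Turnstile> r \<longleftrightarrow> X \<Turnstile> r"
  using assms by (auto simp: sat_def)

lemma satisfies_hard_insert_fresh:
  assumes "p \<notin> lpod_literals P"
  shows "satisfies_hard (insert p X) P \<longleftrightarrow> satisfies_hard X P"
proof -
  have "insert p X \<Turnstile> s \<longleftrightarrow> X \<Turnstile> s" if "Regular s \<in># P" for s
    using assms that by (intro sat_insert_fresh) (auto simp: lpod_literals_def)
  moreover have "insert p X \<Turnstile> od_constraint r \<longleftrightarrow> X \<Turnstile> od_constraint r" if "Ordered r \<in># P" for r
    using assms that
    by (intro sat_insert_fresh) (auto simp: lpod_literals_def od_constraint_def fset_of_list.rep_eq)
  ultimately show ?thesis by (simp add: satisfies_hard_def)
qed

lemma deg_insert_fresh:
  assumes "p \<notin> lpod_literals P"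
  shows "deg P (insert p X) = deg P X"
proof -
  have "rule_deg r (insert p X) = rule_deg r X" if "r \<in># ordered_part P" for r
  proof -
    have fresh: "p \<notin> set (choices r)" "p \<notin> fset (od_pbody r)" "p \<notin> fset (od_nbody r)"
      using assms that by (auto simp: lpod_literals_def)
    have "choices r ! (k - 1) \<noteq> p" if "k \<in> {1..option_count r}" for k
      using fresh(1) that nth_mem[of "k - 1" "choices r"] by (auto simp: option_count_def)
    then have "{k \<in> {1..option_count r}. choices r ! (k - 1) \<in> insert p X} =
        {k \<in> {1..option_count r}. choices r ! (k - 1) \<in> X}"
      by auto
    moreover have "od_body_sat (insert p X) r \<longleftrightarrow> od_body_sat X r"
      using fresh by (auto simp: od_body_sat_def)
    moreover have "set (choices r) \<inter> insert p X = set (choices r) \<inter> X"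
      using fresh by auto
    ultimately show ?thesis by (simp add: rule_deg_def)
  qed
  then show ?thesis unfolding deg_def by (metis (mono_tags, lifting) image_mset_cong)
qed

text \<open>\<open>mset_set\<close> is empty on infinite sets, so the rules enumerate
  \<open>X\<close> and \<open>Y\<close> only when these are finite.\<close>

definition selector ::
  "'a literal \<Rightarrow> 'a literal \<Rightarrow> 'a literal set \<Rightarrow> 'a literal set \<Rightarrow> 'a asp_rule multiset" where
  "selector p q X Y = {#Rule {|p, q|} {||} {||}#}
    + image_mset (\<lambda>x. Rule {|x|} {|p|} {||}) (mset_set X)
    + image_mset (\<lambda>y. Rule {|y|} {|q|} {||}) (mset_set Y)"

lemma selector_commute: "selector p q X Y = selector q p Y X"
  by (simp add: selector_def finsert_commute)

text \<open>The selector alone forces minimality. A proper subset without \<open>p\<close> violates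
  the disjunction, since \<open>q\<close> is absent as well; one with \<open>p\<close> misses some
  \<open>x\<close> in \<open>X\<close> and violates the rule deriving \<open>x\<close> from
  \<open>p\<close>. The rules of \<open>P\<close> only have to be satisfied, which freshness of
  \<open>p\<close> preserves.\<close>

lemma insert_in_CSM_selector:
  assumes P: "lpod_program P" "satisfies_hard X P"
    and X: "finite X" "consistent X" and Y: "finite Y"
    and p: "p = Pos a" "Neg a \<notin> X" "p \<notin> lpod_literals P" and q: "q \<notin> X" "q \<noteq> p"
  shows "insert p X \<in> CSM (P + image_mset Regular (selector p q X Y))"
proof -
  let ?X = "insert p X" and ?S = "selector p q X Y"
  let ?\<Pi> = "{r. ?X \<Turnstile> r \<and> (\<exists>w. (w, r) \<in># lpod_to_lpmln (P + image_mset Regular ?S))}"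
  have S: "?X \<Turnstile> s" if "s \<in># ?S" for s
    using that X Y q by (auto simp: selector_def sat_def)
  have S_\<Pi>: "s \<in> ?\<Pi>" if "s \<in># ?S" for s
    using that S by auto
  have "stable_model ?\<Pi> ?X"
    unfolding stable_model_iff
  proof (intro conjI allI impI)
    show "consistent ?X" using X(2) p by (auto simp: consistent_def)
    fix J assume J: "J \<subset> ?X"
    show "\<exists>r \<in> ?\<Pi>. applicable r ?X \<and> fset (pbody r) \<subseteq> J \<and> fset (head r) \<inter> J = {}"
    proof (cases "p \<in> J")
      case False
      have "Rule {|p, q|} {||} {||} \<in> ?\<Pi>" by (rule S_\<Pi>) (simp add: selector_def)
      moreover have "q \<notin> J" using J q by auto
      ultimately show ?thesis using False
        by (intro bexI[of _ "Rule {|p, q|} {||} {||}"]) (simp_all add: applicable_def)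
    next
      case True
      with J obtain x where x: "x \<in> X" "x \<notin> J" by auto
      then have "Rule {|x|} {|p|} {||} \<in> ?\<Pi>" using X by (intro S_\<Pi>) (simp add: selector_def)
      with x True show ?thesis
        by (intro bexI[of _ "Rule {|x|} {|p|} {||}"]) (simp_all add: applicable_def)
    qed
  qed simp
  moreover have "satisfies_hard ?X (P + image_mset Regular ?S)"
    using iffD2[OF satisfies_hard_insert_fresh[OF p(3)] P(2)] S
    by (auto simp: satisfies_hard_def)
  ultimately show ?thesis
    using P(1) by (simp add: CSM_eq_SSM SSM_iff satisfies_hard_iff del: lpod_to_lpmln_union)
qed

lemma exists_fresh_atom:
  assumes "infinite (UNIV :: 'a set)" "finite (S :: 'a literal set)"
  obtains a where "Pos a \<notin> S" "Neg a \<notin> S"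
proof -
  have "finite (Pos -` S \<union> Neg -` S)"
    using assms(2) by (auto intro!: finite_vimageI simp: inj_def)
  then obtain a where "a \<notin> Pos -` S \<union> Neg -` S"
    using ex_new_if_finite[OF assms(1)] by blast
  then show thesis by (intro that) auto
qed

text \<open>The selector makes both interpretations, extended by fresh atoms, candidates of one
  context. Regular rules add no degree and fresh atoms change none, so the equation for that context
  is the equation for \<open>P\<close> and \<open>Q\<close>.\<close>

lemma deg_diff_eq:
  fixes P Q :: "'a lpod"
  assumes inf: "infinite (UNIV :: 'a set)"
    and P: "lpod_program P"
    and equiv: "ps_strongly_equivalent P Q"
    and X: "finite X" "consistent X" "satisfies_hard X P"
    and Y: "finite Y" "consistent Y" "satisfies_hard Y P"
  shows "int (deg P X) - int (deg P Y) = int (deg Q X) - int (deg Q Y)"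
proof -
  let ?L = "X \<union> Y \<union> lpod_literals P \<union> lpod_literals Q"
  have fin: "finite ?L" using X Y by (simp add: finite_lpod_literals)
  obtain a where a: "Pos a \<notin> ?L" "Neg a \<notin> ?L"
    using exists_fresh_atom[OF inf fin] .
  \<comment> \<open>Avoiding \<open>Pos a\<close> makes the two selecting atoms distinct. Avoiding
    the negative literals keeps the extended interpretations consistent.\<close>
  obtain b where b: "Pos b \<notin> insert (Pos a) ?L" "Neg b \<notin> insert (Pos a) ?L"
    using exists_fresh_atom[OF inf, of "insert (Pos a) ?L"] fin by blast
  let ?R = "image_mset Regular (selector (Pos a) (Pos b) X Y)"
  have "insert (Pos a) X \<in> CSM (P + ?R)"
    using P X Y a b by (intro insert_in_CSM_selector) auto
  moreover have "insert (Pos b) Y \<in> CSM (P + ?R)"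
    unfolding selector_commute[of "Pos a"]
    using P X Y a b by (intro insert_in_CSM_selector) auto
  moreover have "lpod_program ?R" by simp
  ultimately have "int (deg (P + ?R) (insert (Pos a) X)) - int (deg (P + ?R) (insert (Pos b) Y)) =
      int (deg (Q + ?R) (insert (Pos a) X)) - int (deg (Q + ?R) (insert (Pos b) Y))"
    using equiv unfolding ps_strongly_equivalent_def by blast
  then show ?thesis using a b by (simp add: deg_insert_fresh)
qed

section \<open>Weights, probabilities and the two implications\<close>

lemma W_s_lpod_context:
  assumes "lpod_program P" "X \<in> SSM (lpod_to_lpmln P + R)"
  shows "W_s (lpod_to_lpmln P + R) X = exp (max_score P - real (deg P X)) * W_s R X"
  using assms soft_score_lpod_to_lpmln[OF _ satisfies_hard_of_SSM]
  by (simp add: W_s_eq_exp exp_add)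

lemma sum_W_s_pos:
  assumes "X \<in> SSM P"
  shows "(\<Sum>X' \<in> SSM P. W_s P X') > 0"
  using assms W_s_pos finite_SSM by (intro sum_pos) auto

text \<open>The positive normalising sum cancels, so probabilities determine weight ratios.\<close>

lemma W_s_ratio:
  assumes "X \<in> SSM P" "Y \<in> SSM P"
  shows "W_s P X / W_s P Y = Pr_s P X / Pr_s P Y"
  using sum_W_s_pos[OF assms(1)] by (simp add: Pr_s_def)

lemma Pr_s_eq_of_proportional:
  assumes "SSM P = SSM Q" "c \<noteq> 0" "X \<in> SSM P"
    and "\<And>Z. Z \<in> SSM P \<Longrightarrow> W_s P Z = c * W_s Q Z"
  shows "Pr_s P X = Pr_s Q X"
proof -
  have "(\<Sum>Z \<in> SSM P. W_s P Z) = c * (\<Sum>Z \<in> SSM Q. W_s Q Z)"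
    using assms(1,4) by (simp add: sum_distrib_left)
  with assms(2-4) show ?thesis by (simp add: Pr_s_def)
qed

text \<open>Two soft stable models of one LPMLN context may call for different LPOD contexts.
  \<open>deg_diff_eq\<close> compares their degrees nevertheless, which makes the weights for
  \<open>P\<close> and \<open>Q\<close> proportional.\<close>

lemma ps_imp_sp:
  fixes P Q :: "'a lpod"
  assumes inf: "infinite (UNIV :: 'a set)"
    and P: "lpod_program P" and Q: "lpod_program Q"
    and equiv: "ps_strongly_equivalent P Q"
  shows "sp_strongly_equivalent (lpod_to_lpmln P) (lpod_to_lpmln Q)"
  unfolding sp_strongly_equivalent_def
proof (intro allI conjI ballI)
  fix R :: "'a lpmln"
  let ?P = "lpod_to_lpmln P + R" and ?Q = "lpod_to_lpmln Q + R"
  have CSM: "CSM (P + R') = CSM (Q + R')" if "lpod_program R'" for R'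
    using equiv that by (simp add: ps_strongly_equivalent_def)
  show eq: "SSM ?P = SSM ?Q"
    using SSM_context_subset[OF P Q CSM] SSM_context_subset[OF Q P CSM[symmetric]] by blast
  fix X assume X: "X \<in> SSM ?P"
  \<comment> \<open>The quotient of the two weights at \<open>Z\<close>, in which the factor
    \<open>W_s R Z\<close> has cancelled. The fixed \<open>X\<close> is the reference point for
    showing that it is constant.\<close>
  let ?c = "\<lambda>Z. exp ((max_score P - real (deg P Z)) - (max_score Q - real (deg Q Z)))"
  show "Pr_s ?P X = Pr_s ?Q X"
  proof (rule Pr_s_eq_of_proportional[OF eq _ X])
    show "?c X \<noteq> 0" by simp
    fix Z assume Z: "Z \<in> SSM ?P"
    have "int (deg P X) - int (deg P Z) = int (deg Q X) - int (deg Q Z)"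
      using X Z by (intro deg_diff_eq[OF inf P equiv])
        (blast intro: finite_of_SSM consistent_of_SSM satisfies_hard_of_SSM)+
    then have "real (deg P X) - real (deg Q X) = real (deg P Z) - real (deg Q Z)"
      by linarith
    then have "?c X = ?c Z" by (simp add: algebra_simps)
    moreover have "W_s ?P Z = ?c Z * W_s ?Q Z"
      using W_s_lpod_context[OF P Z] W_s_lpod_context[OF Q Z[unfolded eq]]
      by (simp add: exp_diff)
    ultimately show "W_s ?P Z = ?c X * W_s ?Q Z" by simp
  qed
qed

lemma W_s_ratio_lpod:
  assumes "lpod_program P" "X \<in> SSM (lpod_to_lpmln P)" "Y \<in> SSM (lpod_to_lpmln P)"
  shows "W_s (lpod_to_lpmln P) X / W_s (lpod_to_lpmln P) Y = exp (real (deg P Y) - real (deg P X))"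
proof -
  have "W_s (lpod_to_lpmln P) Z = exp (max_score P - real (deg P Z))"
    if "Z \<in> SSM (lpod_to_lpmln P)" for Z
    \<comment> \<open>The empty context contributes the factor 1.\<close>
    using W_s_lpod_context[of P Z "{#}"] assms(1) that by (simp add: W_s_eq_exp)
  with assms(2,3) show ?thesis by (simp only: exp_diff[symmetric]) simp
qed

lemma sp_imp_ps:
  assumes P: "lpod_program P" and Q: "lpod_program Q"
    and equiv: "sp_strongly_equivalent (lpod_to_lpmln P) (lpod_to_lpmln Q)"
  shows "ps_strongly_equivalent P Q"
  unfolding ps_strongly_equivalent_def
proof (intro allI impI conjI ballI)
  fix R :: "'a lpod" assume "lpod_program R"
  then have PR: "lpod_program (P + R)" and QR: "lpod_program (Q + R)"
    using P Q by simp_all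
  let ?P = "lpod_to_lpmln (P + R)" and ?Q = "lpod_to_lpmln (Q + R)"
  \<comment> \<open>The translation is additive, so the equivalence is instantiated at the LPMLN
    context \<open>lpod_to_lpmln R\<close>.\<close>
  have SSM: "SSM ?P = SSM ?Q" and Pr: "\<And>Z. Z \<in> SSM ?P \<Longrightarrow> Pr_s ?P Z = Pr_s ?Q Z"
    using equiv by (simp_all add: sp_strongly_equivalent_def)
  show "CSM (P + R) = CSM (Q + R)"
    using SSM PR QR by (simp add: CSM_eq_SSM del: lpod_to_lpmln_union)
  fix X Y assume "X \<in> CSM (P + R)" "Y \<in> CSM (P + R)"
  then have XP: "X \<in> SSM ?P" and YP: "Y \<in> SSM ?P"
    using CSM_subset_SSM by blast+
  then have XQ: "X \<in> SSM ?Q" and YQ: "Y \<in> SSM ?Q" using SSM by simp_all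
  have "W_s ?P X / W_s ?P Y = W_s ?Q X / W_s ?Q Y"
    unfolding W_s_ratio[OF XP YP] W_s_ratio[OF XQ YQ] Pr[OF XP] Pr[OF YP] ..
  \<comment> \<open>Both ratios are exponentials of degree differences, and \<open>exp\<close> is
    injective.\<close>
  then have "real (deg (P + R) Y) - real (deg (P + R) X) =
      real (deg (Q + R) Y) - real (deg (Q + R) X)"
    unfolding W_s_ratio_lpod[OF PR XP YP] W_s_ratio_lpod[OF QR XQ YQ] by simp
  then show "int (deg (P + R) X) - int (deg (P + R) Y) =
      int (deg (Q + R) X) - int (deg (Q + R) Y)"
    by linarith
qed

theorem theorem6p13:
  fixes P Q :: "'a lpod"
  assumes "infinite (UNIV :: 'a set)"
    and "lpod_program P" and "lpod_program Q"
  shows "ps_strongly_equivalent P Q \<longleftrightarrow>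
    sp_strongly_equivalent (lpod_to_lpmln P) (lpod_to_lpmln Q)"
  using ps_imp_sp[OF assms] sp_imp_ps[OF assms(2,3)] by blast

end
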